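(* Let $f_0\in\mathcal F$, let $\epsilon_n\to 0$ be a sequence of positive numbers, let $(M_n)$ be any positive sequence, and let $\Pi$ be a prior distribution on $f\in\mathcal F$. Suppose that for some sequence of sets $(\mathcal S_n)$, $\mathcal S_n\subset\mathcal F$, $$\mathrm E_0\,\Pi\bigl(\mathcal S_n^c\mid Y^n\bigr)\to 0,$$ and that $$\mathrm E_0\,\Pi\bigl(f: d_K(Kf,Kf_0)\ge M_n\epsilon_n\mid Y^n\bigr)\to 0 .$$ Then $$\mathrm E_0\,\Pi\bigl(f: d(f,f_0)\ge \omega(\mathcal S_n,f_0,d,d_K,M_n\epsilon_n)\mid Y^n\bigr)\to 0 .$$
   Context: $(\mathcal F,d)$ and $(K\mathcal F,d_K)$ are metric spaces and $K:\mathcal F\to K\mathcal F$, $f\mapsto Kf$, is a continuous injective map. For each $n$ one observes $Y^n\sim P^n_{Kf}$, where the laws $P^n_{Kf}$, $f\in\mathcal F$, admit densities $p^n_{Kf}$ relative to a $\sigma$-finite measure $\mu^n$. $\Pi(\cdot\mid Y^n)$ is the posterior distribution of $f$, $\Pi(A\mid Y^n)=\int_A p^n_{Kf}(Y^n)\,d\Pi(f)\big/\int_{\mathcal F} p^n_{Kf}(Y^n)\,d\Pi(f)$. $\mathrm E_0$ denotes expectation under the true law $Y^n\sim P^n_{Kf_0}$. The modulus of continuity is, for $\mathcal S\subset\mathcal F$, $f_0\in\mathcal F$ (not assumed to belong to $\mathcal S$) and $\delta>0$, $$\omega(\mathcal S,f_0,d,d_K,\delta):=\sup\bigl\{d(f,f_0):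 f\in\mathcal S,\ d_K(Kf,Kf_0)\le\delta\bigr\}.$$
   Formalization: With ≥ the claim fails (prior a point mass at f_0, S_n={f_0}: ω=0, posterior mass 1). Proved instead: the claim with d(f,f_0) > ω, and the claim with ≥ when also E_0 Π(d(f,f_0)=ω | Y^n)→0, a condition that is also necessary. *)

theory Defs
  imports "HOL-Probability.Probability"
begin

text \<open>The supremum is taken in $[0,\infty]$: it is $\infty$ if the distances are unbounded and
  $0$ if no point of \<open>S\<close> is admissible. The point \<open>f0\<close> need not belong to \<open>S\<close>.\<close>

definition modulus_of_continuity ::
  "('f \<Rightarrow> 'k) \<Rightarrow> 'f set \<Rightarrow> 'f \<Rightarrow> ('f \<Rightarrow> 'f \<Rightarrow> real) \<Rightarrow> ('k \<Rightarrow> 'k \<Rightarrow> real) \<Rightarrow> real \<Rightarrow> ennreal" where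
  "modulus_of_continuity K S f0 d dK \<delta> = (SUP f \<in> {f \<in> S. dK (K f) (K f0) \<le> \<delta>}. ennreal (d f f0))"

text \<open>Bayes' formula for the prior \<open>Pr\<close> and the likelihood \<open>q f y\<close>. At data \<open>y\<close> whose
  marginal density (the denominator) is \<open>0\<close>, the value is \<open>0\<close> by the convention for division.\<close>

definition posterior :: "'f measure \<Rightarrow> ('f \<Rightarrow> 'y \<Rightarrow> ennreal) \<Rightarrow> 'y \<Rightarrow> 'f set \<Rightarrow> ennreal" where
  "posterior Pr q y A = (\<integral>\<^sup>+f\<in>A. q f y \<partial>Pr) / (\<integral>\<^sup>+f. q f y \<partial>Pr)"

end

theory Submission
  imports Defs
begin

text \<open>
  The argument is an inclusion of events together with subadditivity of the expected posterior mass.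
  If \<open>f \<in> S n\<close> and \<open>dist (K f) (K f0) < M n * \<epsilon> n\<close>, then \<open>f\<close> is one of the
  competitors in the supremum that defines the modulus of continuity, so \<open>dist f f0\<close> is at most
  the modulus. Hence a parameter whose distance to \<open>f0\<close> exceeds the modulus lies outside
  \<open>S n\<close> or in the set on which the forward problem fails to contract
  (\<open>modulus_exceeded_subset\<close>). The posterior masses of these two sets vanish in expectation, and
  so does the mass of their union (\<open>expected_posterior_subadditive\<close>,
  \<open>expected_posterior_tendsto_0\<close>).

  The inclusion is for the strict inequality: the supremum can be attained, and at such a point
  the distance equals the modulus. The non-strict event is the union of the strict
  event and the event of equality, so it is covered once the latter has vanishing mass; this is again
  subadditivity.

  The analytic content is measurability of the posterior mass as a function of the data, without
  which the integral over the data need not be additive. It follows from joint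
  measurability of the likelihood and Tonelli's theorem.
\<close>

lemma posterior_subadditive:
  assumes [measurable]: "(\<lambda>f. q f y) \<in> borel_measurable Pr"
    and B: "B \<in> sets Pr" and C: "C \<in> sets Pr" and "A \<subseteq> B \<union> C"
  shows "posterior Pr q y A \<le> posterior Pr q y B + posterior Pr q y C"
proof -
  have "(\<integral>\<^sup>+f\<in>A. q f y \<partial>Pr)
      \<le> (\<integral>\<^sup>+f. q f y * indicator B f + q f y * indicator C f \<partial>Pr)"
    using assms(4) by (intro nn_integral_mono) (auto simp: indicator_def)
  also have "\<dots> = (\<integral>\<^sup>+f\<in>B. q f y \<partial>Pr) + (\<integral>\<^sup>+f\<in>C. q f y \<partial>Pr)"
    using B C by (intro nn_integral_add) auto
  finally show ?thesis
    unfolding posterior_def add_divide_distrib_ennreal[symmetric]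
    by (rule divide_right_mono_ennreal)
qed

text \<open>Numerator and denominator of Bayes' formula are partial integrals of a jointly measurable
  function, to which Tonelli's theorem applies because the prior is \<open>\<sigma>\<close>-finite.\<close>

lemma borel_measurable_posterior:
  assumes "sigma_finite_measure Pr"
    and q: "(\<lambda>(f, y). q f y) \<in> borel_measurable (Pr \<Otimes>\<^sub>M N)"
    and A [measurable]: "A \<in> sets Pr"
  shows "(\<lambda>y. posterior Pr q y A) \<in> borel_measurable N"
proof -
  interpret sigma_finite_measure Pr by fact
  have [measurable]: "(\<lambda>(y, f). q f y) \<in> borel_measurable (N \<Otimes>\<^sub>M Pr)"
    using measurable_compose[OF measurable_pair_swap' q] by (simp add: case_prod_beta')
  show ?thesis
    unfolding posterior_def by measurable
qed

lemma expected_posterior_subadditive: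
  assumes "sigma_finite_measure Pr"
    and q: "(\<lambda>(f, y). q f y) \<in> borel_measurable (Pr \<Otimes>\<^sub>M N)"
    and B: "B \<in> sets Pr" and C: "C \<in> sets Pr" and "A \<subseteq> B \<union> C"
  shows "(\<integral>\<^sup>+y. posterior Pr q y A \<partial>N)
    \<le> (\<integral>\<^sup>+y. posterior Pr q y B \<partial>N) + (\<integral>\<^sup>+y. posterior Pr q y C \<partial>N)"
proof -
  have y_section: "(\<lambda>f. q f y) \<in> borel_measurable Pr" if "y \<in> space N" for y
    using measurable_compose[OF measurable_Pair2'[OF that] q] by simp
  have "(\<integral>\<^sup>+y. posterior Pr q y A \<partial>N)
      \<le> (\<integral>\<^sup>+y. posterior Pr q y B + posterior Pr q y C \<partial>N)"
    using assms(3-5) by (intro nn_integral_mono posterior_subadditive y_section) auto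
  also have "\<dots> = (\<integral>\<^sup>+y. posterior Pr q y B \<partial>N) + (\<integral>\<^sup>+y. posterior Pr q y C \<partial>N)"
    using assms by (intro nn_integral_add borel_measurable_posterior)
  finally show ?thesis .
qed

lemma expected_posterior_tendsto_0:
  fixes q :: "nat \<Rightarrow> 'f \<Rightarrow> 'y \<Rightarrow> ennreal"
  assumes "sigma_finite_measure Pr"
    and "\<And>n. (\<lambda>(f, y). q n f y) \<in> borel_measurable (Pr \<Otimes>\<^sub>M N n)"
    and "\<And>n. B n \<in> sets Pr" and "\<And>n. C n \<in> sets Pr"
    and "\<And>n. A n \<subseteq> B n \<union> C n"
    and B: "(\<lambda>n. \<integral>\<^sup>+y. posterior Pr (q n) y (B n) \<partial>N n) \<longlonglongrightarrow> 0"
    and C: "(\<lambda>n. \<integral>\<^sup>+y. posterior Pr (q n) y (C n) \<partial>N n) \<longlonglongrightarrow> 0"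
  shows "(\<lambda>n. \<integral>\<^sup>+y. posterior Pr (q n) y (A n) \<partial>N n) \<longlonglongrightarrow> 0"
proof (rule tendsto_sandwich[OF _ _ tendsto_const])
  show "(\<lambda>n. (\<integral>\<^sup>+y. posterior Pr (q n) y (B n) \<partial>N n)
      + (\<integral>\<^sup>+y. posterior Pr (q n) y (C n) \<partial>N n)) \<longlonglongrightarrow> 0"
    using tendsto_add[OF B C] by simp
qed (simp_all add: always_eventually expected_posterior_subadditive[OF assms(1-5)])

text \<open>The contrapositive of the fact that every admissible point of \<open>S\<close> bounds the supremum
  from below.\<close>

lemma modulus_exceeded_subset:
  "{f. ennreal (d f f0) > modulus_of_continuity K S f0 d dK \<delta>}
    \<subseteq> - S \<union> {f. dK (K f) (K f0) \<ge> \<delta>}"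
proof -
  have "ennreal (d f f0) \<le> modulus_of_continuity K S f0 d dK \<delta>"
    if "f \<in> S" "dK (K f) (K f0) < \<delta>" for f
    unfolding modulus_of_continuity_def using that by (intro SUP_upper) auto
  then show ?thesis
    by (force simp: not_less[symmetric])
qed

theorem theorem2p1:
  fixes K :: "'f::metric_space \<Rightarrow> 'k::metric_space"
    and \<mu> :: "nat \<Rightarrow> 'y measure"
    and P :: "nat \<Rightarrow> 'k \<Rightarrow> 'y measure"
    and p :: "nat \<Rightarrow> 'k \<Rightarrow> 'y \<Rightarrow> ennreal"
    and Pr :: "'f measure"
    and f0 :: 'f
    and \<epsilon> M :: "nat \<Rightarrow> real"
    and S :: "nat \<Rightarrow> 'f set"
  assumes K: "continuous_on UNIV K" "inj K"
    and \<mu>: "\<And>n. sigma_finite_measure (\<mu> n)"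
    and P: "\<And>n f. prob_space (P n (K f))"
    and P_density: "\<And>n f. P n (K f) = density (\<mu> n) (p n (K f))"
    and prior: "prob_space Pr" "sets Pr = sets borel"
    and p_meas: "\<And>n. (\<lambda>(f, y). p n (K f) y) \<in> borel_measurable (Pr \<Otimes>\<^sub>M \<mu> n)"
    and \<epsilon>: "\<And>n. \<epsilon> n > 0" "\<epsilon> \<longlonglongrightarrow> 0"
    and M: "\<And>n. M n > 0"
    and S_meas: "\<And>n. S n \<in> sets Pr"
    and S: "(\<lambda>n. \<integral>\<^sup>+y. posterior Pr (\<lambda>f. p n (K f)) y
        (- S n) \<partial>P n (K f0)) \<longlonglongrightarrow> 0"
    and contraction: "(\<lambda>n. \<integral>\<^sup>+y. posterior Pr (\<lambda>f. p n (K f)) y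
        {f. dist (K f) (K f0) \<ge> M n * \<epsilon> n} \<partial>P n (K f0)) \<longlonglongrightarrow> 0"
  shows "(\<lambda>n. \<integral>\<^sup>+y. posterior Pr (\<lambda>f. p n (K f)) y
        {f. ennreal (dist f f0) > modulus_of_continuity K (S n) f0 dist dist (M n * \<epsilon> n)} \<partial>P n (K f0)) \<longlonglongrightarrow> 0 \<and>
    ((\<lambda>n. \<integral>\<^sup>+y. posterior Pr (\<lambda>f. p n (K f)) y
        {f. ennreal (dist f f0) = modulus_of_continuity K (S n) f0 dist dist (M n * \<epsilon> n)} \<partial>P n (K f0)) \<longlonglongrightarrow> 0 \<longrightarrow>
     (\<lambda>n. \<integral>\<^sup>+y. posterior Pr (\<lambda>f. p n (K f)) y
        {f. ennreal (dist f f0) \<ge> modulus_of_continuity K (S n) f0 dist dist (M n * \<epsilon> n)} \<partial>P n (K f0)) \<longlonglongrightarrow> 0)"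
proof -
  interpret Pr: prob_space Pr by (rule prior)
  let ?\<omega> = "\<lambda>n. modulus_of_continuity K (S n) f0 dist dist (M n * \<epsilon> n)"
  have likelihood: "(\<lambda>(f, y). p n (K f) y) \<in> borel_measurable (Pr \<Otimes>\<^sub>M P n (K f0))" for n
    using p_meas[of n] unfolding P_density
    by (simp cong: measurable_cong_sets add: sets_pair_measure_cong[OF refl sets_density])
  have compl: "- S n \<in> sets Pr" for n
    using S_meas[of n] prior(2) by (metis borel_comp)
  have "closed {f. M n * \<epsilon> n \<le> dist (K f) (K f0)}" for n
    by (intro closed_Collect_le continuous_intros K)
  then have no_contraction: "{f. M n * \<epsilon> n \<le> dist (K f) (K f0)} \<in> sets Pr" for n
    using prior(2) by simp
  have [measurable]: "(\<lambda>f. ennreal (dist f f0)) \<in> borel_measurable borel"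
    by (intro measurable_compose[OF _ measurable_ennreal] borel_measurable_continuous_onI
        continuous_intros)
  have exceeds: "{f. ennreal (dist f f0) > ?\<omega> n} \<in> sets Pr"
    and attains: "{f. ennreal (dist f f0) = ?\<omega> n} \<in> sets Pr" for n
    unfolding prior(2) by measurable
  note vanishing = expected_posterior_tendsto_0
    [where q = "\<lambda>n f. p n (K f)" and N = "\<lambda>n. P n (K f0)",
      OF Pr.sigma_finite_measure_axioms likelihood]
  have strict: "(\<lambda>n. \<integral>\<^sup>+y. posterior Pr (\<lambda>f. p n (K f)) y
      {f. ennreal (dist f f0) > ?\<omega> n} \<partial>P n (K f0)) \<longlonglongrightarrow> 0"
    by (rule vanishing[where B = "\<lambda>n. - S n", OF compl no_contraction _ S contraction])
      (rule modulus_exceeded_subset)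
  have split: "{f. ennreal (dist f f0) \<ge> ?\<omega> n}
      \<subseteq> {f. ennreal (dist f f0) > ?\<omega> n} \<union> {f. ennreal (dist f f0) = ?\<omega> n}" for n
    by (auto simp: order.order_iff_strict)
  show ?thesis
    using strict vanishing[where A = "\<lambda>n. {f. ennreal (dist f f0) \<ge> ?\<omega> n}",
        OF exceeds attains split strict] by blast
qed

end
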